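(* For any integers $k,q,m$ with $0\le k<q$ and $m\ge1$, the graph $H_{k,q;m}$ satisfies property $P(k,q;m)$.
   Context: $[n]=\{1,\ldots,n\}$ and $\binom{S}{k}$ denotes the family of $k$-element subsets of $S$. For integers $1\le k<q$, $m\ge1$ and $i\in[q]$, let $\mathcal{F}_i$ be the set of all functions $f:\binom{[q]\setminus\{i\}}{k}\to[m]$; $H_{k,q;m}$ is the graph with vertex set the disjoint union $\bigcup_{i=1}^q\mathcal{F}_i$ in which $f\in\mathcal{F}_i$ and $g\in\mathcal{F}_j$ are adjacent if and only if $i\neq j$ and $f,g$ agree on $\binom{[q]\setminus\{i,j\}}{k}$. For $k=0$, $H_{0,q;m}$ is defined to be $mK_q$, the disjoint union of $m$ copies of the complete graph $K_q$. A graph $G$ satisfies property $P(k,q;m)$ (for integers $0\le k<q$, $m\ge1$) if: (1) all maximal cliques of $G$ have size $q$; (2) each clique of size $k+1$ in $G$ is contained in a unique maximal clique; (3) each clique of size $k$ in $G$ is contained in at least $m$ maximal cliques. (Cliques are vertex sets, the empty set being the clique of size $0$.) *)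

theory Defs
  imports "Graph_Theory.Graph_Theory" "HOL-Library.FuncSet" "HOL-Library.Ramsey"
begin

text \<open>Finite simple graphs are instances of the locale \<^locale>\<open>pair_graph\<close>, i.e. symmetric loop-free
  digraphs; an edge is represented by its two arcs.\<close>

definition clique :: "'v pair_pre_digraph \<Rightarrow> 'v set \<Rightarrow> bool" where
  "clique G K \<longleftrightarrow> K \<subseteq> pverts G \<and> (\<forall>u\<in>K. \<forall>v\<in>K. u \<noteq> v \<longrightarrow> (u, v) \<in> parcs G)"

definition maximal_clique :: "'v pair_pre_digraph \<Rightarrow> 'v set \<Rightarrow> bool" where
  "maximal_clique G M \<longleftrightarrow> clique G M \<and> (\<forall>K. clique G K \<and> M \<subseteq> K \<longrightarrow> K = M)"

text \<open>The finiteness conditions are needed because \<^const>\<open>card\<close> is 0 on infinite sets. "At least \<open>m\<close>" is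
  expressed by a family of exactly \<open>m\<close> maximal cliques, which is also right when there are
  infinitely many.\<close>

definition property_P :: "nat \<Rightarrow> nat \<Rightarrow> nat \<Rightarrow> 'v pair_pre_digraph \<Rightarrow> bool" where
  "property_P k q m G \<longleftrightarrow>
     (\<forall>M. maximal_clique G M \<longrightarrow> finite M \<and> card M = q) \<and>
     (\<forall>K. clique G K \<and> finite K \<and> card K = k + 1 \<longrightarrow> (\<exists>!M. maximal_clique G M \<and> K \<subseteq> M)) \<and>
     (\<forall>K. clique G K \<and> finite K \<and> card K = k \<longrightarrow>
        (\<exists>\<M>. finite \<M> \<and> card \<M> = m \<and> (\<forall>M\<in>\<M>. maximal_clique G M \<and> K \<subseteq> M)))"

text \<open>\<open>Copy a v\<close> is the vertex \<open>v\<close> in the \<open>a\<close>-th copy of \<open>K\<^sub>q\<close> (used for \<open>k = 0\<close>); \<open>Fn i f\<close> is \<open>f\<close> viewed as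
  an element of \<open>F\<^sub>i\<close> (used for \<open>k \<ge> 1\<close>), the tag \<open>i\<close> making the union of the \<open>F\<^sub>i\<close> disjoint.\<close>

datatype H_vertex = Copy nat nat | Fn nat "nat set \<Rightarrow> nat"

text \<open>\<^term>\<open>[S]\<^bsup>k\<^esup>\<close> is the family of \<open>k\<close>-element subsets of \<open>S\<close>. The extensional function space
  makes two elements of \<open>F\<^sub>i\<close> equal as soon as they agree on their domain.\<close>

definition F :: "nat \<Rightarrow> nat \<Rightarrow> nat \<Rightarrow> nat \<Rightarrow> (nat set \<Rightarrow> nat) set" where
  "F k q m i = [{1..q} - {i}]\<^bsup>k\<^esup> \<rightarrow>\<^sub>E {1..m}"

definition copies_of_complete_graph :: "nat \<Rightarrow> nat \<Rightarrow> H_vertex pair_pre_digraph" where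
  "copies_of_complete_graph m q =
     \<lparr> pverts = {Copy a v |a v. a \<in> {1..m} \<and> v \<in> {1..q}},
       parcs = {(Copy a u, Copy a v) |a u v. a \<in> {1..m} \<and> u \<in> {1..q} \<and> v \<in> {1..q} \<and> u \<noteq> v} \<rparr>"

definition function_graph :: "nat \<Rightarrow> nat \<Rightarrow> nat \<Rightarrow> H_vertex pair_pre_digraph" where
  "function_graph k q m =
     \<lparr> pverts = {Fn i f |i f. i \<in> {1..q} \<and> f \<in> F k q m i},
       parcs = {(Fn i f, Fn j g) |i f j g.
         i \<in> {1..q} \<and> f \<in> F k q m i \<and> j \<in> {1..q} \<and> g \<in> F k q m j \<and>
         i \<noteq> j \<and> (\<forall>A \<in> [{1..q} - {i, j}]\<^bsup>k\<^esup>. f A = g A)} \<rparr>"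

definition H :: "nat \<Rightarrow> nat \<Rightarrow> nat \<Rightarrow> H_vertex pair_pre_digraph" where
  "H k q m = (if k = 0 then copies_of_complete_graph m q else function_graph k q m)"

lemma finite_F: "finite (F k q m i)"
  unfolding F_def by (intro finite_PiE finite_imp_finite_nsets) auto

lemma pair_graphI:
  assumes "finite (pverts G)" "parcs G \<subseteq> pverts G \<times> pverts G"
    and "sym (parcs G)" "irrefl (parcs G)"
  shows "pair_graph G"
proof -
  have "finite (parcs G)"
    using assms(1,2) by (meson finite_SigmaI finite_subset)
  moreover have "symmetric (with_proj G)"
    using assms(3) by (simp add: symmetric_def)
  ultimately show ?thesis
    using assms by unfold_locales (auto simp: irrefl_def)
qed

lemma pair_graph_H: "pair_graph (H k q m)"
proof (cases "k = 0")
  case True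
  have "pverts (H k q m) = (\<lambda>(a, v). Copy a v) ` ({1..m} \<times> {1..q})"
    using True by (auto simp: H_def copies_of_complete_graph_def)
  then have "finite (pverts (H k q m))" by simp
  then show ?thesis
    by (rule pair_graphI)
      (use True in \<open>auto simp: H_def copies_of_complete_graph_def sym_def irrefl_def\<close>)
next
  case False
  have "pverts (H k q m) = (\<lambda>(i, f). Fn i f) ` (SIGMA i:{1..q}. F k q m i)"
    using False by (auto simp: H_def function_graph_def)
  then have "finite (pverts (H k q m))" by (simp add: finite_F)
  moreover have "sym (parcs (H k q m))"
    using False by (auto simp: H_def function_graph_def sym_def insert_commute)
  ultimately show ?thesis
    by (intro pair_graphI) (use False in \<open>auto simp: H_def function_graph_def irrefl_def\<close>)
qed

end

theory Submission
  imports Defs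
begin

text \<open>Restricting a function \<open>h\<close> on all \<open>k\<close>-subsets of \<open>[q]\<close> to the \<open>k\<close>-subsets of \<open>[q] - {i}\<close>,
  for each \<open>i\<close>, gives a clique with one vertex in each \<open>F\<^sub>i\<close>. Conversely, the functions in a clique
  agree wherever two of them are defined, so they glue to such an \<open>h\<close>; hence these are exactly the
  maximal cliques. A clique meeting \<open>F\<^sub>i\<close> for \<open>i \<in> I\<close> prescribes \<open>h A\<close> precisely for those \<open>A\<close> that
  do not contain \<open>I\<close>: for \<open>|I| = k + 1\<close> this is everything, and for \<open>|I| = k\<close> the only free value
  is \<open>h I\<close>, which leaves \<open>m\<close> choices.\<close>

text \<open>Since the sets \<open>C h\<close> all have the same finite size, none lies properly
  inside another; since every clique lies in one of them, no other clique is maximal.\<close>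

lemma maximal_clique_iff_cover:
  assumes clique: "\<And>h. h \<in> X \<Longrightarrow> clique G (C h)"
    and card: "\<And>h. h \<in> X \<Longrightarrow> card (C h) = q"
    and fin: "\<And>h. h \<in> X \<Longrightarrow> finite (C h)"
    and cover: "\<And>K. clique G K \<Longrightarrow> \<exists>h\<in>X. K \<subseteq> C h"
  shows "maximal_clique G M \<longleftrightarrow> M \<in> C ` X"
proof
  assume M: "maximal_clique G M"
  then obtain h where "h \<in> X" "M \<subseteq> C h"
    using cover by (meson maximal_clique_def)
  then show "M \<in> C ` X"
    using M clique by (auto simp: maximal_clique_def)
next
  assume "M \<in> C ` X"
  then obtain h where h: "h \<in> X" "M = C h" by auto
  have "K = M" if "clique G K" "M \<subseteq> K" for K
  proof -
    obtain h' where h': "h' \<in> X" "K \<subseteq> C h'"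
      using cover \<open>clique G K\<close> by auto
    then have "M = C h'"
      using that h by (intro card_subset_eq) (auto simp: card fin)
    then show ?thesis
      using h' that by auto
  qed
  then show "maximal_clique G M"
    using h clique by (auto simp: maximal_clique_def)
qed

text \<open>Shared frame for \<open>k = 0\<close> and for the function graph: property P is reduced
  to statements about the indices \<open>h\<close>. Injectivity of \<open>C\<close> turns
  \<open>m\<close> indices into \<open>m\<close> distinct maximal cliques.\<close>

lemma property_P_cover:
  assumes clique: "\<And>h. h \<in> X \<Longrightarrow> clique G (C h)"
    and card: "\<And>h. h \<in> X \<Longrightarrow> card (C h) = q"
    and fin: "\<And>h. h \<in> X \<Longrightarrow> finite (C h)"
    and cover: "\<And>K. clique G K \<Longrightarrow> \<exists>h\<in>X. K \<subseteq> C h"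
    and inj: "inj_on C X"
    and unique: "\<And>K h h'. h \<in> X \<Longrightarrow> h' \<in> X \<Longrightarrow> K \<subseteq> C h \<Longrightarrow> K \<subseteq> C h' \<Longrightarrow> card K = k + 1 \<Longrightarrow> h = h'"
    and many: "\<And>K h. h \<in> X \<Longrightarrow> K \<subseteq> C h \<Longrightarrow> card K = k \<Longrightarrow>
                 \<exists>Y\<subseteq>X. finite Y \<and> card Y = m \<and> (\<forall>h\<in>Y. K \<subseteq> C h)"
  shows "property_P k q m G"
proof -
  have max_iff: "maximal_clique G M \<longleftrightarrow> M \<in> C ` X" for M
    by (rule maximal_clique_iff_cover[OF clique card fin cover])
  have "\<exists>!M. maximal_clique G M \<and> K \<subseteq> M" if "clique G K" "card K = k + 1" for K
    unfolding max_iff using cover[OF \<open>clique G K\<close>] unique that(2) by blast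
  moreover have "\<exists>\<M>. finite \<M> \<and> card \<M> = m \<and> (\<forall>M\<in>\<M>. maximal_clique G M \<and> K \<subseteq> M)"
    if K: "clique G K" "card K = k" for K
  proof -
    obtain h where "h \<in> X" "K \<subseteq> C h"
      using cover[OF K(1)] by blast
    from many[OF this K(2)] obtain Y
      where "Y \<subseteq> X" "finite Y" "card Y = m" "\<forall>h\<in>Y. K \<subseteq> C h"
      by blast
    moreover from this have "card (C ` Y) = m"
      using inj by (metis card_image inj_on_subset)
    ultimately show ?thesis
      unfolding max_iff by (intro exI[of _ "C ` Y"]) auto
  qed
  ultimately show ?thesis
    unfolding property_P_def by (auto simp: max_iff card fin)
qed

text \<open>The maximal cliques are the \<open>m\<close> copies: a single vertex determines its
  copy, and the empty clique lies in every copy.\<close>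

lemma property_P_copies_of_complete_graph:
  assumes "0 < q" "1 \<le> m"
  shows "property_P 0 q m (copies_of_complete_graph m q)"
proof (rule property_P_cover[where X = "{1..m}" and C = "\<lambda>a. Copy a ` {1..q}"])
  fix K assume K: "clique (copies_of_complete_graph m q) K"
  show "\<exists>a\<in>{1..m}. K \<subseteq> Copy a ` {1..q}"
  proof (cases "K = {}")
    case True
    then show ?thesis using \<open>1 \<le> m\<close> by (intro bexI[of _ 1]) auto
  next
    case False
    then obtain a v where av: "Copy a v \<in> K" "a \<in> {1..m}" "v \<in> {1..q}"
      using K by (fastforce simp: clique_def copies_of_complete_graph_def)
    have "w \<in> Copy a ` {1..q}" if "w \<in> K" for w
    proof (cases "w = Copy a v")
      case False
      then have "(Copy a v, w) \<in> parcs (copies_of_complete_graph m q)"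
        using K av that unfolding clique_def by metis
      then show ?thesis by (auto simp: copies_of_complete_graph_def)
    qed (use av in auto)
    then show ?thesis using av by blast
  qed
next
  show "inj_on (\<lambda>a. Copy a ` {1..q}) {1..m}"
    \<comment> \<open>Copies are told apart by their vertices, so they must be nonempty.\<close>
    using \<open>0 < q\<close> by (intro inj_onI) (fastforce simp: set_eq_iff image_iff)
next
  fix K :: "H_vertex set" and a b
  assume "K \<subseteq> Copy a ` {1..q}" "K \<subseteq> Copy b ` {1..q}" "card K = 0 + 1"
  then show "a = b"
    by (auto simp: card_1_singleton_iff)
next
  fix K :: "H_vertex set" and a
  assume "K \<subseteq> Copy a ` {1..q}" "card K = 0"
  then have "K = {}"
    by (metis card_0_eq finite_atLeastAtMost finite_imageI finite_subset)
  then show "\<exists>Y\<subseteq>{1..m}. finite Y \<and> card Y = m \<and> (\<forall>a\<in>Y. K \<subseteq> Copy a ` {1..q})"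
    by (intro exI[of _ "{1..m}"]) auto
next
  fix a assume "a \<in> {1..m}"
  then show "clique (copies_of_complete_graph m q) (Copy a ` {1..q})"
    by (auto simp: clique_def copies_of_complete_graph_def)
qed (simp_all add: card_image inj_on_def)

definition restriction_vertex :: "nat \<Rightarrow> nat \<Rightarrow> (nat set \<Rightarrow> nat) \<Rightarrow> nat \<Rightarrow> H_vertex" where
  "restriction_vertex k q h i = Fn i (restrict h ([{1..q} - {i}]\<^bsup>k\<^esup>))"

lemma inj_on_restriction_vertex: "inj_on (restriction_vertex k q h) I"
  by (auto simp: restriction_vertex_def inj_on_def)

lemma clique_restriction_vertices:
  assumes "h \<in> [{1..q}]\<^bsup>k\<^esup> \<rightarrow>\<^sub>E {1..m}"
  shows "clique (function_graph k q m) (restriction_vertex k q h ` {1..q})"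
proof -
  have "restrict h ([{1..q} - {i}]\<^bsup>k\<^esup>) \<in> F k q m i" for i
    using assms nsets_mono[of "{1..q} - {i}" "{1..q}" k]
    unfolding F_def restrict_PiE_iff by (auto simp: PiE_iff)
  then show ?thesis
    by (auto simp: clique_def function_graph_def restriction_vertex_def nsets_def)
qed

text \<open>Adjacency gives agreement away from both tags. The case \<open>i = j\<close> is
  included: distinct functions with the same tag are not adjacent, so there the two vertices
  coincide.\<close>

lemma clique_function_graph_agree:
  assumes "clique (function_graph k q m) K" "Fn i f \<in> K" "Fn j g \<in> K"
    and "A \<in> [{1..q}]\<^bsup>k\<^esup>" "i \<notin> A" "j \<notin> A"
  shows "f A = g A"
proof (cases "Fn i f = Fn j g")
  case False
  then have "(Fn i f, Fn j g) \<in> parcs (function_graph k q m)"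
    using assms unfolding clique_def by metis
  moreover have "A \<in> [{1..q} - {i, j}]\<^bsup>k\<^esup>"
    using assms by (auto simp: nsets_def)
  ultimately show ?thesis
    by (auto simp: function_graph_def)
qed auto

lemma clique_function_graph_glue:
  assumes K: "clique (function_graph k q m) K" and "1 \<le> m"
  obtains h where "h \<in> [{1..q}]\<^bsup>k\<^esup> \<rightarrow>\<^sub>E {1..m}" "K \<subseteq> restriction_vertex k q h ` {1..q}"
proof -
  have vertex: "\<exists>i f. v = Fn i f \<and> i \<in> {1..q} \<and> f \<in> F k q m i" if "v \<in> K" for v
    using K that by (auto simp: clique_def function_graph_def)
  have "\<forall>A\<in>[{1..q}]\<^bsup>k\<^esup>. \<exists>c\<in>{1..m}. \<forall>i f. Fn i f \<in> K \<and> i \<notin> A \<longrightarrow> f A = c"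
  proof
    fix A assume A: "A \<in> [{1..q}]\<^bsup>k\<^esup>"
    show "\<exists>c\<in>{1..m}. \<forall>i f. Fn i f \<in> K \<and> i \<notin> A \<longrightarrow> f A = c"
    proof (cases "\<exists>i f. Fn i f \<in> K \<and> i \<notin> A")
      case True
      then obtain i f where f: "Fn i f \<in> K" "i \<notin> A" by auto
      moreover have "A \<in> [{1..q} - {i}]\<^bsup>k\<^esup>"
        using A f by (auto simp: nsets_def)
      ultimately have "f A \<in> {1..m}"
        using vertex[of "Fn i f"] by (auto simp: F_def PiE_iff)
      then show ?thesis
        using clique_function_graph_agree[OF K _ _ A] f by blast
    next
      case False
      \<comment> \<open>Every tag occurring in \<open>K\<close> lies in \<open>A\<close>, so nothing
        prescribes a value at \<open>A\<close>; the default 1 is admissible.\<close>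
      then show ?thesis using \<open>1 \<le> m\<close> by (intro bexI[of _ 1]) auto
    qed
  qed
  then obtain h where h: "\<And>A. A \<in> [{1..q}]\<^bsup>k\<^esup> \<Longrightarrow> h A \<in> {1..m}"
    and agree: "\<And>A i f. \<lbrakk>A \<in> [{1..q}]\<^bsup>k\<^esup>; Fn i f \<in> K; i \<notin> A\<rbrakk> \<Longrightarrow> f A = h A"
    by metis
  \<comment> \<open>The chosen \<open>h\<close> is arbitrary off the \<open>k\<close>-subsets;
    restricting it puts it into the extensional function space.\<close>
  define h' where "h' = restrict h ([{1..q}]\<^bsup>k\<^esup>)"
  have "v \<in> restriction_vertex k q h' ` {1..q}" if vK: "v \<in> K" for v
  proof -
    obtain i f where v: "v = Fn i f" "i \<in> {1..q}" "f \<in> F k q m i"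
      using vertex[OF vK] by blast
    have "f = restrict h' ([{1..q} - {i}]\<^bsup>k\<^esup>)"
    proof
      fix A
      show "f A = restrict h' ([{1..q} - {i}]\<^bsup>k\<^esup>) A"
      proof (cases "A \<in> [{1..q} - {i}]\<^bsup>k\<^esup>")
        case True
        then have "A \<in> [{1..q}]\<^bsup>k\<^esup>" "i \<notin> A" by (auto simp: nsets_def)
        then show ?thesis using agree vK v True by (simp add: h'_def)
      next
        case False
        then show ?thesis using v by (simp add: F_def PiE_arb[of f])
      qed
    qed
    then show ?thesis using v by (auto simp: restriction_vertex_def)
  qed
  moreover have "h' \<in> [{1..q}]\<^bsup>k\<^esup> \<rightarrow>\<^sub>E {1..m}"
    using h by (simp add: h'_def)
  ultimately show thesis using that by blast
qed

text \<open>The vertices of \<open>K\<close> carry more than \<open>k\<close> distinct tags, so each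
  \<open>k\<close>-set \<open>A\<close> misses one of them, and the vertex with that tag records the
  value at \<open>A\<close>.\<close>

lemma restriction_vertices_determine:
  assumes h: "h \<in> [{1..q}]\<^bsup>k\<^esup> \<rightarrow>\<^sub>E {1..m}" and h': "h' \<in> [{1..q}]\<^bsup>k\<^esup> \<rightarrow>\<^sub>E {1..m}"
    and K: "K \<subseteq> restriction_vertex k q h ` {1..q}" "K \<subseteq> restriction_vertex k q h' ` {1..q}"
    and "k < card K"
  shows "h = h'"
proof (rule PiE_ext[OF h h'])
  fix A assume A: "A \<in> [{1..q}]\<^bsup>k\<^esup>"
  obtain I where I: "I \<subseteq> {1..q}" "K = restriction_vertex k q h ` I"
    using K(1) by (auto simp: subset_image_iff)
  then have "card A < card I"
    using A \<open>k < card K\<close> by (simp add: card_image inj_on_restriction_vertex nsets_def)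
  then obtain i where i: "i \<in> I" "i \<notin> A"
    using A by (metis (no_types, lifting) card_mono leD mem_Collect_eq nsets_def subsetI)
  then have "A \<in> [{1..q} - {i}]\<^bsup>k\<^esup>"
    using A by (auto simp: nsets_def)
  \<comment> \<open>The tag \<open>i\<close> forces this vertex to be the \<open>i\<close>-th
    restriction of \<open>h'\<close> as well.\<close>
  moreover have "restriction_vertex k q h i \<in> restriction_vertex k q h' ` {1..q}"
    using I i K(2) by auto
  then have "restrict h ([{1..q} - {i}]\<^bsup>k\<^esup>) = restrict h' ([{1..q} - {i}]\<^bsup>k\<^esup>)"
    by (auto simp: restriction_vertex_def)
  ultimately show "h A = h' A"
    by (metis restrict_apply')
qed

text \<open>The tags of \<open>K\<close> form a \<open>k\<close>-set \<open>I\<close>, and the value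
  \<open>h I\<close> can be replaced by any of the \<open>m\<close> colours without changing a
  vertex of \<open>K\<close>.\<close>

lemma restriction_vertices_extensions:
  assumes h: "h \<in> [{1..q}]\<^bsup>k\<^esup> \<rightarrow>\<^sub>E {1..m}"
    and K: "K \<subseteq> restriction_vertex k q h ` {1..q}" "card K = k"
  shows "\<exists>Y\<subseteq>[{1..q}]\<^bsup>k\<^esup> \<rightarrow>\<^sub>E {1..m}. finite Y \<and> card Y = m \<and>
           (\<forall>h'\<in>Y. K \<subseteq> restriction_vertex k q h' ` {1..q})"
proof -
  obtain I where I: "I \<subseteq> {1..q}" "K = restriction_vertex k q h ` I"
    using K(1) by (auto simp: subset_image_iff)
  then have "I \<in> [{1..q}]\<^bsup>k\<^esup>"
    using K(2) finite_subset[OF I(1)]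
    by (simp add: card_image inj_on_restriction_vertex nsets_def)
  then have "(\<lambda>c. h(I := c)) ` {1..m} \<subseteq> [{1..q}]\<^bsup>k\<^esup> \<rightarrow>\<^sub>E {1..m}"
    using h by (auto simp: PiE_iff extensional_def)
  moreover have "inj_on (\<lambda>c. h(I := c)) {1..m}"
    by (auto simp: inj_on_def fun_upd_eqD)
  then have "card ((\<lambda>c. h(I := c)) ` {1..m}) = m"
    by (simp add: card_image)
  \<comment> \<open>For \<open>i\<close> in \<open>I\<close>, the set \<open>I\<close> is not a
    subset of \<open>{1..q} - {i}\<close>, so the restriction never sees the changed value.\<close>
  moreover have "restriction_vertex k q (h(I := c)) i = restriction_vertex k q h i" if "i \<in> I" for c i
    using that by (auto simp: restriction_vertex_def fun_eq_iff nsets_def)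
  then have "K \<subseteq> restriction_vertex k q (h(I := c)) ` {1..q}" for c
    unfolding I(2) using I(1) by (metis image_cong image_mono)
  ultimately show ?thesis
    by (intro exI[of _ "(\<lambda>c. h(I := c)) ` {1..m}"]) auto
qed

lemma property_P_function_graph:
  assumes "k < q" "1 \<le> m"
  shows "property_P k q m (function_graph k q m)"
proof (rule property_P_cover[where X = "[{1..q}]\<^bsup>k\<^esup> \<rightarrow>\<^sub>E {1..m}"
        and C = "\<lambda>h. restriction_vertex k q h ` {1..q}"])
  have card: "card (restriction_vertex k q h ` {1..q}) = q" for h
    by (simp add: card_image inj_on_restriction_vertex)
  then show "card (restriction_vertex k q h ` {1..q}) = q" for h .
  show "inj_on (\<lambda>h. restriction_vertex k q h ` {1..q}) ([{1..q}]\<^bsup>k\<^esup> \<rightarrow>\<^sub>E {1..m})"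
    \<comment> \<open>The determination lemma is applied with \<open>K\<close> the whole clique,
      whose \<open>q\<close> vertices exceed \<open>k\<close>.\<close>
    using \<open>k < q\<close> card by (intro inj_onI restriction_vertices_determine[OF _ _ order_refl]) auto
  show "\<exists>h\<in>[{1..q}]\<^bsup>k\<^esup> \<rightarrow>\<^sub>E {1..m}. K \<subseteq> restriction_vertex k q h ` {1..q}"
    if "clique (function_graph k q m) K" for K
    using clique_function_graph_glue[OF that \<open>1 \<le> m\<close>] by blast
  show "h = h'"
    if "h \<in> [{1..q}]\<^bsup>k\<^esup> \<rightarrow>\<^sub>E {1..m}" "h' \<in> [{1..q}]\<^bsup>k\<^esup> \<rightarrow>\<^sub>E {1..m}"
      "K \<subseteq> restriction_vertex k q h ` {1..q}" "K \<subseteq> restriction_vertex k q h' ` {1..q}"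
      "card K = k + 1" for K h h'
    using restriction_vertices_determine[OF that(1-4)] that(5) by simp
qed (rule clique_restriction_vertices restriction_vertices_extensions finite_imageI
       finite_atLeastAtMost | assumption)+

theorem theorem2p3:
  fixes k q m :: nat
  assumes "k < q" and "m \<ge> 1"
  shows "property_P k q m (H k q m)"
  using assms property_P_copies_of_complete_graph property_P_function_graph
  by (simp add: H_def)

end
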